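(* Let $(\lambda_n)_{n\ge 0}$ be positive numbers with $\lambda_n \uparrow +\infty$ (that is, $\lambda_n$ increases monotonically to $+\infty$). Then there exists a continuous function $f$ on $\mathbb{T}$ such that \[ \sum_{n\in\mathbb{Z}} |\widehat{f}(n)|^2 \lambda_{|n|} = \infty . \]
   Context: $\mathbb{T}$ is the unit circle in $\mathbb{C}$, $dm$ is arc-length measure on $\mathbb{T}$ normalized so that $m(\mathbb{T})=1$, and $\widehat{f}(n)=\int_{\mathbb{T}} f(\zeta)\overline{\zeta}^{\,n}\,dm(\zeta)$, $n\in\mathbb{Z}$, are the Fourier coefficients of $f$. Functions are complex-valued. *)

theory Defs
  imports "HOL-Probability.Probability"
begin

abbreviation unit_circle :: "complex set" where
  "unit_circle \<equiv> sphere 0 1"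

text \<open>Normalized arc length on the unit circle: the image of the uniform probability measure
  on \<open>[0, 2\<pi>)\<close> under the arc-length parametrization \<open>cis t = exp (\<i> t)\<close>.\<close>

definition circle_measure :: "complex measure" where
  "circle_measure =
     distr (uniform_measure lborel {0..<2*pi}) (restrict_space borel unit_circle) cis"

definition fourier_coeff :: "(complex \<Rightarrow> complex) \<Rightarrow> int \<Rightarrow> complex" where
  "fourier_coeff f n = (\<integral>\<zeta>. f \<zeta> * (cnj \<zeta>) powi n \<partial>circle_measure)"

lemma measurable_cis_circle:
  "cis \<in> measurable (uniform_measure lborel {0..<2*pi}) (restrict_space borel unit_circle)"
proof (rule measurable_restrict_space2)
  have "cis \<in> borel_measurable borel"
    by (intro borel_measurable_continuous_onI continuous_intros)
  then show "cis \<in> borel_measurable (uniform_measure lborel {0..<2*pi})"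
    by (simp add: measurable_def)
qed simp

lemma space_circle_measure [simp]: "space circle_measure = unit_circle"
  by (simp add: circle_measure_def space_restrict_space)

lemma prob_space_circle_measure: "prob_space circle_measure"
  unfolding circle_measure_def
  by (intro prob_space.prob_space_distr prob_space_uniform_measure measurable_cis_circle)
     (simp_all add: ennreal_eq_0_iff not_le)

end

theory Submission
  imports Defs
begin

text \<open>Choose distinct frequencies \<open>r 0, r 1, \<dots>\<close> with \<open>lam (r k) \<ge> 4 ^ k\<close>.  The lacunary series
  \<open>\<Sum>k. 2 ^ -k * \<zeta> ^ r k\<close> converges uniformly on the circle, so it is continuous and its Fourier
  coefficient at \<open>r k\<close> is \<open>2 ^ -k\<close>; each of these frequencies contributes at least \<open>1\<close> to the
  weighted sum.\<close>

lemma AE_circle_measure: "AE z in circle_measure. cmod z = 1"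
  by (rule AE_I2) simp

lemma borel_measurable_circle_measure:
  "f \<in> borel_measurable borel \<Longrightarrow> f \<in> borel_measurable circle_measure"
  by (simp add: circle_measure_def measurable_restrict_space1)

text \<open>Change of variables along the parametrization \<open>cis\<close>, with density
  \<open>1 / (2*pi)\<close>. The interval is closed, although \<open>circle_measure\<close> comes
  from a half-open one, so that the fundamental theorem of calculus on \<open>{0..2*pi}\<close>
  applies directly.\<close>

lemma integral_circle_measure:
  fixes f :: "complex \<Rightarrow> complex"
  assumes f: "continuous_on UNIV f"
  shows "integral\<^sup>L circle_measure f = (\<integral>t. indicator {0..2*pi} t *\<^sub>R f (cis t) \<partial>lborel) / (2*pi)"
proof -
  have [measurable]: "(\<lambda>t. f (cis t)) \<in> borel_measurable borel"
    by (intro borel_measurable_continuous_onI continuous_on_compose2[OF f] continuous_intros) auto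
  have "f \<in> borel_measurable borel"
    using f by (rule borel_measurable_continuous_onI)
  then have "integral\<^sup>L circle_measure f =
      (\<integral>t. f (cis t) \<partial>uniform_measure lborel {0..<2*pi})"
    unfolding circle_measure_def
    by (intro integral_distr measurable_cis_circle measurable_restrict_space1)
  also have "uniform_measure lborel {0..<2*pi} =
      density lborel (\<lambda>t. ennreal (indicator {0..<2*pi} t / (2*pi)))"
    unfolding uniform_measure_def
    by (intro arg_cong[where f = "density lborel"] ext)
       (auto simp: divide_ennreal[symmetric] split: split_indicator)
  also have "(\<integral>t. f (cis t) \<partial>\<dots>) = (\<integral>t. (indicator {0..<2*pi} t / (2*pi)) *\<^sub>R f (cis t) \<partial>lborel)"
    by (rule integral_density) (auto split: split_indicator)
  \<comment> \<open>The integrands can differ only at the endpoint \<open>2*pi\<close>, which is a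
    null set.\<close>
  also have "\<dots> = (\<integral>t. (indicator {0..2*pi} t *\<^sub>R f (cis t)) / (2*pi) \<partial>lborel)"
  proof (rule integral_cong_AE)
    show "AE t in lborel. (indicator {0..<2*pi} t / (2*pi)) *\<^sub>R f (cis t) =
        (indicator {0..2*pi} t *\<^sub>R f (cis t)) / (2*pi)"
      using AE_lborel_singleton[of "2*pi"]
      by eventually_elim (auto split: split_indicator simp: scaleR_conv_of_real)
  qed auto
  finally show ?thesis by simp
qed

text \<open>Orthonormality of the characters: along \<open>cis t\<close> the integrand is
  \<open>cis (k * t)\<close> with the integer \<open>k = m - n\<close>. For \<open>k = 0\<close> it
  is constantly 1; otherwise it has a \<open>2*pi\<close>-periodic primitive, so its integral over a
  full period vanishes.\<close>

lemma integral_circle_power_cnj_power: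
  "(\<integral>z. z ^ m * cnj z ^ n \<partial>circle_measure) = (if m = n then 1 else 0)"
proof -
  define k where "k = real m - real n"
  have "cis t ^ m * cnj (cis t) ^ n = cis (k * t)" for t
    by (simp add: Complex.DeMoivre cis_cnj cis_mult k_def algebra_simps)
  then have eq: "(\<integral>z. z ^ m * cnj z ^ n \<partial>circle_measure) =
      (\<integral>t. indicator {0..2*pi} t *\<^sub>R cis (k * t) \<partial>lborel) / (2*pi)"
    by (subst integral_circle_measure) (auto intro!: continuous_intros)
  show ?thesis
  proof (cases "m = n")
    case True
    then show ?thesis
      using eq by (simp add: k_def scaleR_conv_of_real)
  next
    case False
    then have "k \<noteq> 0"
      by (simp add: k_def)
    have "(\<integral>t. indicator {0..2*pi} t *\<^sub>R cis (k * t) \<partial>lborel) =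
        cis (k * (2*pi)) / (\<i> * k) - cis (k * 0) / (\<i> * k)"
    proof (rule integral_FTC_Icc)
      show "((\<lambda>t. cis (k * t) / (\<i> * k)) has_vector_derivative cis (k * t)) (at t within {0..2*pi})"
        for t
      proof -
        \<comment> \<open>Differentiate the entire function of a complex variable first, then
          restrict it to the real line.\<close>
        have "((\<lambda>z. exp (\<i> * (k * z)) / (\<i> * k)) has_field_derivative exp (\<i> * (k * of_real t)))
            (at (of_real t))"
          using \<open>k \<noteq> 0\<close> by (auto intro!: derivative_eq_intros simp: mult_ac)
        from has_vector_derivative_real_field[OF this] show ?thesis
          by (simp add: cis_conv_exp)
      qed
    qed (auto intro!: continuous_intros)
    \<comment> \<open>Since \<open>k\<close> is an integer, the primitive takes the same value at
      both endpoints and the difference cancels.\<close>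
    also have "cis (k * (2*pi)) = 1"
      using cis_multiple_2pi[of k] by (simp add: k_def mult.commute)
    finally show ?thesis
      using eq False by simp
  qed
qed

text \<open>Absolute summability permits integration term by term, and orthonormality kills every
  term whose frequency is not \<open>r j\<close>. Injectivity of \<open>r\<close> ensures that only
  the index \<open>j\<close> survives.\<close>

lemma fourier_coeff_lacunary:
  fixes a :: "nat \<Rightarrow> complex"
  assumes a: "summable (\<lambda>k. cmod (a k))" and r: "inj r"
  shows "fourier_coeff (\<lambda>z. \<Sum>k. a k * z ^ r k) (int (r j)) = a j"
proof -
  interpret prob_space circle_measure
    by (rule prob_space_circle_measure)
  let ?g = "\<lambda>k z. a k * (z ^ r k * cnj z ^ r j)"
  have norm_g: "cmod (?g k z) = cmod (a k)" if "cmod z = 1" for k z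
    using that by (simp add: norm_mult norm_power)
  have int: "integrable circle_measure (?g k)" for k
  proof (rule integrable_const_bound)
    show "AE z in circle_measure. cmod (?g k z) \<le> cmod (a k)"
      using AE_circle_measure by eventually_elim (simp add: norm_g del: norm_mult)
    show "?g k \<in> borel_measurable circle_measure"
      by (intro borel_measurable_circle_measure borel_measurable_continuous_onI continuous_intros)
  qed
  \<comment> \<open>On the circle the \<open>k\<close>-th term has constant modulus
    \<open>cmod (a k)\<close>, and the total mass is 1. Hence pointwise summability and summability
    of the integrated norms both reduce to the assumption on \<open>a\<close>.\<close>
  have "(\<lambda>k. \<integral>z. ?g k z \<partial>circle_measure) sums (\<integral>z. (\<Sum>k. ?g k z) \<partial>circle_measure)"
  proof (rule sums_integral[OF int])
    show "AE z in circle_measure. summable (\<lambda>k. cmod (?g k z))"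
      using AE_circle_measure by eventually_elim (simp add: norm_g a)
    have "(\<integral>z. cmod (?g k z) \<partial>circle_measure) = cmod (a k)" for k
    proof -
      have "(\<integral>z. cmod (?g k z) \<partial>circle_measure) = (\<integral>z. cmod (a k) \<partial>circle_measure)"
        by (rule Bochner_Integration.integral_cong[OF refl]) (simp only: space_circle_measure norm_g mem_sphere_0)
      then show ?thesis
        by (simp add: prob_space[simplified])
    qed
    then show "summable (\<lambda>k. \<integral>z. cmod (?g k z) \<partial>circle_measure)"
      using a by simp
  qed
  moreover have "(\<integral>z. ?g k z \<partial>circle_measure) = (if k = j then a k else 0)" for k
    using r by (simp add: integral_circle_power_cnj_power inj_eq)
  ultimately have "(\<integral>z. (\<Sum>k. ?g k z) \<partial>circle_measure) = a j"
    using sums_single[of j a] by (simp add: sums_unique2)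
  moreover have "fourier_coeff (\<lambda>z. \<Sum>k. a k * z ^ r k) (int (r j)) =
      (\<integral>z. (\<Sum>k. ?g k z) \<partial>circle_measure)"
    unfolding fourier_coeff_def
  proof (rule Bochner_Integration.integral_cong[OF refl])
    fix z assume "z \<in> space circle_measure"
    then have "summable (\<lambda>k. a k * z ^ r k)"
      by (intro summable_norm_cancel[where f = "\<lambda>k. a k * z ^ r k"])
         (simp add: norm_mult norm_power a)
    from suminf_mult2[OF this, of "cnj z ^ r j"]
    show "(\<Sum>k. a k * z ^ r k) * cnj z powi int (r j) = (\<Sum>k. ?g k z)"
      by (simp add: mult.assoc)
  qed
  ultimately show ?thesis
    by simp
qed

text \<open>The partial sums are polynomials and converge uniformly on the circle by the Weierstrass
  M-test with majorant \<open>cmod (a k)\<close>.\<close>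

lemma continuous_on_circle_lacunary:
  fixes a :: "nat \<Rightarrow> complex"
  assumes "summable (\<lambda>k. cmod (a k))"
  shows "continuous_on unit_circle (\<lambda>z. \<Sum>k. a k * z ^ r k)"
proof (rule uniform_limit_theorem)
  show "uniform_limit unit_circle (\<lambda>n z. \<Sum>k<n. a k * z ^ r k) (\<lambda>z. \<Sum>k. a k * z ^ r k) sequentially"
    using assms by (intro Weierstrass_m_test[where M = "\<lambda>k. cmod (a k)"])
      (simp_all add: norm_mult norm_power)
qed (auto intro!: always_eventually continuous_intros)

text \<open>Past any index there is a later one where \<open>lam\<close> exceeds a given bound, so
  the \<open>r k\<close> can be chosen recursively. Strict growth later supplies distinct
  frequencies.\<close>

lemma strict_mono_choice_ge:
  fixes lam :: "nat \<Rightarrow> real"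
  assumes "filterlim lam at_top sequentially"
  obtains r :: "nat \<Rightarrow> nat" where "strict_mono r" "\<And>k. b k \<le> lam (r k)"
proof -
  have ex: "\<exists>y>x. c \<le> lam y" for x c
  proof -
    have "eventually (\<lambda>n. c \<le> lam n \<and> x < n) sequentially"
      using assms by (intro eventually_conj eventually_gt_at_top) (simp add: filterlim_at_top)
    then show ?thesis
      using eventually_happens'[OF sequentially_bot] by blast
  qed
  have "\<exists>r. \<forall>k. b k \<le> lam (r k) \<and> r k < r (Suc k)"
    by (rule dependent_nat_choice) (use ex in blast)+
  then show ?thesis
    using that by (auto simp: strict_mono_Suc_iff)
qed

lemma infsum_ennreal_eq_top:
  fixes g :: "'a \<Rightarrow> ennreal" and h :: "nat \<Rightarrow> 'a"
  assumes h: "inj h" and ge: "\<And>k. 1 \<le> g (h k)"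
  shows "infsum g UNIV = \<infinity>"
proof -
  have "of_nat K \<le> infsum g UNIV" for K
  proof -
    have "of_nat K = (\<Sum>k<K. 1 :: ennreal)"
      by simp
    also have "\<dots> \<le> (\<Sum>k<K. g (h k))"
      by (intro sum_mono ge)
    also have "\<dots> = sum g (h ` {..<K})"
      using h by (simp add: sum.reindex inj_on_subset)
    also have "\<dots> = infsum g (h ` {..<K})"
      by simp
    also have "\<dots> \<le> infsum g UNIV"
      by (rule infsum_mono_neutral) (auto simp: nonneg_summable_on_complete)
    finally show ?thesis .
  qed
  then show ?thesis
    using ennreal_Ex_less_of_nat by (metis infinity_ennreal_def leD less_top)
qed

theorem theorem1p1:
  fixes lam :: "nat \<Rightarrow> real"
  assumes pos: "\<And>n. 0 < lam n"
    and mono: "incseq lam"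
    and lim: "filterlim lam at_top sequentially"
  shows "\<exists>f :: complex \<Rightarrow> complex. continuous_on unit_circle f \<and>
    (\<Sum>\<^sub>\<infinity>n\<in>UNIV. ennreal ((cmod (fourier_coeff f n))\<^sup>2 * lam (nat \<bar>n\<bar>))) = \<infinity>"
proof -
  obtain r where r: "strict_mono r" and lam_r: "\<And>k. 4 ^ k \<le> lam (r k)"
    using strict_mono_choice_ge[OF lim, of "\<lambda>k. 4 ^ k"] by blast
  then have "inj r"
    by (simp add: strict_mono_imp_inj_on)
  define a :: "nat \<Rightarrow> complex" where "a k = (1/2) ^ k" for k
  have summable: "summable (\<lambda>k. cmod (a k))"
    by (simp add: a_def norm_power norm_divide)
  define f where "f z = (\<Sum>k. a k * z ^ r k)" for z
  have coeff: "fourier_coeff f (int (r k)) = a k" for k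
    using fourier_coeff_lacunary[OF summable \<open>inj r\<close>] by (simp add: f_def[abs_def])
  have "1 \<le> (cmod (a k))\<^sup>2 * lam (r k)" for k
  proof -
    \<comment> \<open>The bound \<open>4 ^ k\<close> was chosen as the reciprocal of the squared
      coefficient, so the base on the right is 1.\<close>
    have "(cmod (a k))\<^sup>2 * 4 ^ k = ((1/2)\<^sup>2 * 4) ^ k"
      by (simp only: power_mult_distrib a_def norm_power norm_divide norm_one norm_numeral
          flip: power_mult) (simp add: mult.commute)
    then have "1 = (cmod (a k))\<^sup>2 * 4 ^ k"
      by (simp add: power2_eq_square)
    also have "\<dots> \<le> (cmod (a k))\<^sup>2 * lam (r k)"
      by (intro mult_left_mono lam_r) simp
    finally show ?thesis .
  qed
  then have "(\<Sum>\<^sub>\<infinity>n\<in>UNIV. ennreal ((cmod (fourier_coeff f n))\<^sup>2 * lam (nat \<bar>n\<bar>))) = \<infinity>"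
    \<comment> \<open>The nonnegative frequencies \<open>int (r k)\<close> suffice for divergence;
      there the weight index \<open>nat \<bar>n\<bar>\<close> is \<open>r k\<close>.\<close>
    using \<open>inj r\<close> by (intro infsum_ennreal_eq_top[of "\<lambda>k. int (r k)"])
      (simp_all add: coeff inj_def)
  moreover have "continuous_on unit_circle f"
    unfolding f_def using summable by (rule continuous_on_circle_lacunary)
  ultimately show ?thesis
    by blast
qed

end
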